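(* For every complex number $a$ with $5a\notin\{0,-1,-2,\dots\}$, $$F_1\left(2a;\,a+\tfrac12,\,5a-\tfrac32;\,5a;\,\tfrac{125}{128},\tfrac58\right)=\frac{2^{18a-1}}{3^{3a}5^{5a}}\,\frac{\Gamma(a)^2\,\Gamma(5a)}{\Gamma(2a)^2\,\Gamma(3a)}.$$
   Context: Appell's hypergeometric series is $F_1(\alpha;\beta_1,\beta_2;\gamma;x,y)=\sum_{m,n\ge0}\frac{(\alpha,m+n)(\beta_1,m)(\beta_2,n)}{(\gamma,m+n)(1,m)(1,n)}x^my^n$ for $\gamma\notin\{0,-1,-2,\dots\}$, absolutely convergent for $|x|<1$, $|y|<1$, where $(\alpha,n)=\alpha(\alpha+1)\cdots(\alpha+n-1)$, $(\alpha,0)=1$. For real $r>0$, $r^{a}=e^{a\log r}$ with real $\log r$. $1/\Gamma$ is the entire function (zero at the poles of $\Gamma$). *)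

theory Defs
  imports "HOL-Analysis.Analysis"
begin

text \<open>Appell's series, as an unconditional sum over all pairs of indices; it is only meaningful for
  \<open>\<gamma> \<notin> \<int>\<^sub>\<le>\<^sub>0\<close>, \<open>norm x < 1\<close>, \<open>norm y < 1\<close>.  The symbol \<open>(\<alpha>, n)\<close> is \<^term>\<open>pochhammer \<alpha> n\<close>, and
  \<open>(1, n) = n!\<close>.\<close>

definition appell_F1 :: "complex \<Rightarrow> complex \<Rightarrow> complex \<Rightarrow> complex \<Rightarrow> complex \<Rightarrow> complex \<Rightarrow> complex" where
  "appell_F1 \<alpha> \<beta>\<^sub>1 \<beta>\<^sub>2 \<gamma> x y =
     (\<Sum>\<^sub>\<infinity>(m, n)\<in>(UNIV :: (nat \<times> nat) set).
        (pochhammer \<alpha> (m + n) * pochhammer \<beta>\<^sub>1 m * pochhammer \<beta>\<^sub>2 n) /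
        (pochhammer \<gamma> (m + n) * pochhammer 1 m * pochhammer 1 n) * x ^ m * y ^ n)"

end

theory Submission
  imports Defs "HOL-Complex_Analysis.Complex_Analysis"
begin

text \<open>For real \<open>a > 1\<close>, Euler's integral represents the series as an integral over \<open>[0, 1]\<close> whose
  integrand is, up to an algebraic factor, the \<open>a\<close>-th power of a rational function \<open>\<phi>\<close> of degree 6.
  At the special arguments \<open>\<phi>\<close> is a Belyi map: the substitution \<open>s (1 - s) = const \<cdot> \<phi>(t)\<close> turns
  the integral into the complete Beta integral of \<open>B(a, a)\<close>.  Both sides are holomorphic on the
  connected set \<open>5 a \<notin> \<int>\<^sub>\<le>\<^sub>0\<close>, so the identity theorem gives all other parameters.\<close>

section \<open>Binomial series and their majorants\<close>

lemma pochhammer_nonneg_of_nonneg: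
  fixes b :: real
  assumes "0 \<le> b"
  shows "0 \<le> pochhammer b n"
  using assms by (auto simp: pochhammer_prod intro!: prod_nonneg)

lemma norm_pochhammer_le:
  fixes b :: "'a :: {real_normed_algebra_1, comm_ring_1}"
  assumes "norm b \<le> R"
  shows "norm (pochhammer b n) \<le> pochhammer R n"
proof (induction n)
  case (Suc n)
  have "0 \<le> R"
    using assms norm_ge_zero order_trans by blast
  have "norm (b + of_nat n) \<le> R + of_nat n"
    using norm_triangle_ineq[of b "of_nat n"] assms by simp
  then have "norm (pochhammer b n) * norm (b + of_nat n) \<le> pochhammer R n * (R + of_nat n)"
    using Suc \<open>0 \<le> R\<close> by (intro mult_mono) (auto simp: pochhammer_nonneg_of_nonneg)
  then show ?case
    by (simp add: pochhammer_Suc) (meson norm_mult_ineq order_trans)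
qed simp

text \<open>The generalised binomial coefficient of \<open>- b\<close> over \<open>n\<close> is
  \<open>(-1) ^ n * pochhammer b n / fact n\<close>, so Newton's series at \<open>- x\<close> has
  only plus signs left.\<close>

lemma binomial_series_sums:
  fixes b x :: real
  assumes "\<bar>x\<bar> < 1"
  shows "(\<lambda>n. pochhammer b n / fact n * x ^ n) sums (1 - x) powr (- b)"
  using gen_binomial_real[of "- x" "- b"] assms
  by (simp add: gbinomial_pochhammer power_minus[of x] mult_ac)

lemma norm_binomial_term_le:
  fixes b x :: "'a :: {real_normed_field}"
  assumes "norm b \<le> R" "norm x \<le> r"
  shows "norm (pochhammer b n / fact n * x ^ n) \<le> pochhammer R n / fact n * r ^ n"
proof -
  have "0 \<le> R"
    using assms norm_ge_zero order_trans by blast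
  then show ?thesis
    unfolding norm_mult norm_divide norm_power norm_fact
    by (intro mult_mono divide_right_mono norm_pochhammer_le power_mono assms)
      (auto simp: pochhammer_nonneg_of_nonneg)
qed

lemma norm_double_binomial_term_le:
  fixes b c x y :: "'a :: {real_normed_field}"
  assumes "norm b \<le> R" "norm c \<le> R'" "norm x \<le> r" "norm y \<le> r'"
  shows "norm (pochhammer b m / fact m * x ^ m * (pochhammer c n / fact n * y ^ n)) \<le>
    pochhammer R m / fact m * r ^ m * (pochhammer R' n / fact n * r' ^ n)"
proof -
  have "0 \<le> R" "0 \<le> r"
    using assms norm_ge_zero order_trans by blast+
  then show ?thesis
    by (subst norm_mult, intro mult_mono norm_binomial_term_le assms)
      (auto simp: pochhammer_nonneg_of_nonneg)
qed

lemma binomial_series_has_sum: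
  fixes b x :: real
  assumes "\<bar>x\<bar> < 1"
  shows "((\<lambda>n. pochhammer b n / fact n * x ^ n) has_sum (1 - x) powr (- b)) UNIV"
proof (rule norm_summable_imp_has_sum)
  have "summable (\<lambda>n. pochhammer \<bar>b\<bar> n / fact n * \<bar>x\<bar> ^ n)"
    using binomial_series_sums[of "\<bar>x\<bar>" "\<bar>b\<bar>"] assms by (auto intro: sums_summable)
  then show "summable (\<lambda>n. norm (pochhammer b n / fact n * x ^ n))"
    by (rule summable_comparison_test') (use norm_binomial_term_le[of b "\<bar>b\<bar>" x "\<bar>x\<bar>"] in auto)
qed (rule binomial_series_sums[OF assms])

text \<open>All terms are nonnegative, so summing first over \<open>n\<close> and then over
  \<open>m\<close> already gives unconditional summability. This family majorises every double
  series below.\<close>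

lemma summable_on_double_binomial:
  fixes b c x y :: real
  assumes "0 \<le> b" "0 \<le> c" "0 \<le> x" "x < 1" "0 \<le> y" "y < 1"
  shows "(\<lambda>(m, n). pochhammer b m / fact m * x ^ m * (pochhammer c n / fact n * y ^ n))
    summable_on UNIV"
proof -
  have "(\<lambda>(m, n). pochhammer b m / fact m * x ^ m * (pochhammer c n / fact n * y ^ n))
    summable_on UNIV \<times> UNIV"
  proof (rule summable_on_SigmaI)
    show "((\<lambda>n. case (m, n) of (m, n) \<Rightarrow>
        pochhammer b m / fact m * x ^ m * (pochhammer c n / fact n * y ^ n)) has_sum
        pochhammer b m / fact m * x ^ m * (1 - y) powr (- c)) UNIV" for m
      unfolding prod.case using assms by (intro has_sum_cmult_right binomial_series_has_sum) auto
    show "(\<lambda>m. pochhammer b m / fact m * x ^ m * (1 - y) powr (- c)) summable_on UNIV"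
      using assms binomial_series_has_sum[of x b]
      by (intro summable_on_cmult_left) (auto simp: summable_on_def)
  qed (use assms in \<open>auto simp: pochhammer_nonneg_of_nonneg\<close>)
  then show ?thesis
    by simp
qed

text \<open>The product of two binomial series as one unconditional double sum. Replacing
  \<open>b\<close>, \<open>c\<close>, \<open>x\<close>, \<open>y\<close> by their absolute values
  gives the absolute summability that justifies the iterated evaluation.\<close>

lemma double_binomial_has_sum:
  fixes b c x y :: real
  assumes "\<bar>x\<bar> < 1" "\<bar>y\<bar> < 1"
  shows "((\<lambda>(m, n). pochhammer b m / fact m * x ^ m * (pochhammer c n / fact n * y ^ n)) has_sum
    (1 - x) powr (- b) * (1 - y) powr (- c)) UNIV"
proof -
  let ?f = "\<lambda>(m, n). pochhammer b m / fact m * x ^ m * (pochhammer c n / fact n * y ^ n)"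
  have "(?f has_sum (1 - x) powr (- b) * (1 - y) powr (- c)) (UNIV \<times> UNIV)"
  proof (rule has_sum_SigmaI)
    show "((\<lambda>n. ?f (m, n)) has_sum pochhammer b m / fact m * x ^ m * (1 - y) powr (- c)) UNIV" for m
      unfolding prod.case using assms by (intro has_sum_cmult_right binomial_series_has_sum) auto
    show "((\<lambda>m. pochhammer b m / fact m * x ^ m * (1 - y) powr (- c)) has_sum
        (1 - x) powr (- b) * (1 - y) powr (- c)) UNIV"
      using assms by (intro has_sum_cmult_left binomial_series_has_sum) auto
    have "(\<lambda>z. norm (?f z)) summable_on UNIV"
    proof (rule summable_on_comparison_test)
      show "(\<lambda>(m, n). pochhammer \<bar>b\<bar> m / fact m * \<bar>x\<bar> ^ m * (pochhammer \<bar>c\<bar> n / fact n * \<bar>y\<bar> ^ n))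
          summable_on UNIV"
        using assms by (intro summable_on_double_binomial) auto
      show "norm (?f z) \<le> (\<lambda>(m, n). pochhammer \<bar>b\<bar> m / fact m * \<bar>x\<bar> ^ m *
          (pochhammer \<bar>c\<bar> n / fact n * \<bar>y\<bar> ^ n)) z" for z
        unfolding case_prod_beta by (intro norm_double_binomial_term_le) auto
    qed auto
    then show "?f summable_on UNIV \<times> UNIV"
      by (simp add: abs_summable_summable)
  qed
  then show ?thesis
    by simp
qed

section \<open>Holomorphic dependence on the parameters\<close>

text \<open>Consecutive ratios are multiplied by \<open>(f z + n) / (g z + n)\<close>, which tends
  to 1 uniformly on \<open>K\<close>. From some \<open>N\<close> on, each step therefore costs at
  most a factor \<open>q\<close>; the finitely many earlier ratios are bounded by
  compactness.\<close>

lemma pochhammer_ratio_bound: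
  fixes f g :: "complex \<Rightarrow> complex"
  assumes "compact K" "continuous_on K f" "continuous_on K g"
    and g: "\<And>z. z \<in> K \<Longrightarrow> g z \<notin> \<int>\<^sub>\<le>\<^sub>0" and "1 < q"
  shows "\<exists>C\<ge>0. \<forall>z\<in>K. \<forall>n. norm (pochhammer (f z) n / pochhammer (g z) n) \<le> C * q ^ n"
proof -
  let ?r = "\<lambda>n z. pochhammer (f z) n / pochhammer (g z) n"
  have nz: "pochhammer (g z) n \<noteq> 0" if "z \<in> K" for z n
    using g[OF that] pochhammer_eq_0_imp_nonpos_Int by blast
  have "continuous_on K (?r n)" for n
    unfolding pochhammer_prod using assms nz[unfolded pochhammer_prod] by (intro continuous_intros) auto
  then have "\<exists>B. \<forall>z\<in>K. norm (?r n z) \<le> B" for n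
    using compact_imp_bounded[OF compact_continuous_image[OF _ \<open>compact K\<close>]]
    by (force simp: bounded_iff)
  then obtain B where B: "\<And>n z. z \<in> K \<Longrightarrow> norm (?r n z) \<le> B n"
    by metis
  have "bounded (f ` K \<union> g ` K)"
    using assms by (auto intro: compact_imp_bounded compact_continuous_image)
  then obtain R where R: "\<And>z. z \<in> K \<Longrightarrow> norm (f z) \<le> R" "\<And>z. z \<in> K \<Longrightarrow> norm (g z) \<le> R"
    by (auto simp: bounded_iff)
  \<comment> \<open>\<open>N\<close> is chosen so that \<open>R + n \<le> q * (n - R)\<close> for
    all \<open>n \<ge> N\<close>; this rearranges to
    \<open>R * (1 + q) \<le> n * (q - 1)\<close>.\<close>
  obtain N :: nat where N: "R * (1 + q) / (q - 1) < N"
    using reals_Archimedean2 by blast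
  define C where "C = (\<Sum>n\<le>N. \<bar>B n\<bar>)"
  have "0 \<le> C"
    by (auto simp: C_def intro: sum_nonneg)
  have step: "norm ((f z + of_nat n) / (g z + of_nat n)) \<le> q" if "z \<in> K" "N \<le> n" for z n
  proof -
    have "R * (1 + q) < real N * (q - 1)"
      using N \<open>1 < q\<close> by (simp add: pos_divide_less_eq)
    also have "\<dots> \<le> real n * (q - 1)"
      using \<open>1 < q\<close> that(2) by (intro mult_right_mono) auto
    finally have "R * (1 + q) < real n * (q - 1)" .
    then have "R + n \<le> q * (n - R)"
      by (simp add: algebra_simps)
    have "norm (f z + of_nat n) \<le> R + n"
      using norm_triangle_ineq[of "f z" "of_nat n"] R(1)[OF that(1)] by simp
    also have "\<dots> \<le> q * (n - R)"
      by fact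
    also have "\<dots> \<le> q * norm (g z + of_nat n)"
      using norm_triangle_ineq2[of "of_nat n" "- g z"] R(2)[OF that(1)] \<open>1 < q\<close>
      by (simp add: add.commute)
    finally show ?thesis
      using \<open>1 < q\<close> by (cases "g z + of_nat n = 0") (auto simp: norm_divide divide_le_eq)
  qed
  have "norm (?r n z) \<le> C * q ^ n" if "z \<in> K" for n z
  proof (induction n)
    case 0
    have "norm (?r 0 z) \<le> \<bar>B 0\<bar>"
      using B[OF that, of 0] by simp
    also have "\<dots> \<le> C"
      unfolding C_def by (rule member_le_sum) auto
    finally show ?case
      by simp
  next
    case (Suc n)
    show ?case
    proof (cases "Suc n \<le> N")
      case True
      have "norm (?r (Suc n) z) \<le> \<bar>B (Suc n)\<bar>"
        using B[OF that, of "Suc n"] by simp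
      also have "\<dots> \<le> C"
        unfolding C_def by (rule member_le_sum) (use True in auto)
      also have "\<dots> \<le> C * q ^ Suc n"
        using \<open>0 \<le> C\<close> \<open>1 < q\<close> one_le_power[of q "Suc n"] by (intro mult_le_cancel_left1[THEN iffD2]) auto
      finally show ?thesis .
    next
      case False
      have "norm (?r (Suc n) z) = norm (?r n z) * norm ((f z + of_nat n) / (g z + of_nat n))"
        by (simp add: pochhammer_Suc norm_mult norm_divide)
      also have "\<dots> \<le> C * q ^ n * q"
        using Suc step[OF that] False \<open>0 \<le> C\<close> \<open>1 < q\<close> by (intro mult_mono) auto
      finally show ?thesis
        by (simp add: mult_ac)
    qed
  qed
  then show ?thesis
    using \<open>0 \<le> C\<close> by blast
qed

text \<open>The Weierstrass M-test on closed discs exhibits the series as a locally uniform limit of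
  holomorphic finite sums. The quotient of the \<open>\<alpha>\<close> and \<open>\<gamma>\<close>
  symbols may grow like \<open>q ^ (m + n)\<close>, which the slack in \<open>norm x < 1\<close> and
  \<open>norm y < 1\<close> absorbs.\<close>

lemma appell_F1_holomorphic:
  assumes "open S" and hol: "\<alpha> holomorphic_on S" "\<beta> holomorphic_on S" "\<beta>' holomorphic_on S"
      "\<gamma> holomorphic_on S"
    and \<gamma>: "\<And>a. a \<in> S \<Longrightarrow> \<gamma> a \<notin> \<int>\<^sub>\<le>\<^sub>0"
    and xy: "norm x < 1" "norm y < 1"
  shows "(\<lambda>a. appell_F1 (\<alpha> a) (\<beta> a) (\<beta>' a) (\<gamma> a) x y) holomorphic_on S"
proof -
  define T where "T = (\<lambda>p a. case p of (m, n) \<Rightarrow>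
    (pochhammer (\<alpha> a) (m + n) * pochhammer (\<beta> a) m * pochhammer (\<beta>' a) n) /
    (pochhammer (\<gamma> a) (m + n) * pochhammer 1 m * pochhammer 1 n) * x ^ m * y ^ n)"
  have T: "appell_F1 (\<alpha> a) (\<beta> a) (\<beta>' a) (\<gamma> a) x y = (\<Sum>\<^sub>\<infinity>p. T p a)" for a
    unfolding appell_F1_def T_def by (simp add: case_prod_unfold)
  have nz: "pochhammer (\<gamma> a) n \<noteq> 0" if "a \<in> S" for a n
    using \<gamma>[OF that] pochhammer_eq_0_imp_nonpos_Int by blast
  have holT: "T p holomorphic_on S" for p
    unfolding T_def case_prod_beta using nz
    by (intro holomorphic_intros hol) (auto simp: pochhammer_fact[symmetric])
  have "\<exists>q>1. q * norm x < 1 \<and> q * norm y < 1"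
  proof -
    \<comment> \<open>For \<open>0 \<le> M < 1\<close> the choice \<open>q = 2 / (1 + M)\<close>
      works, since \<open>2 * M < 1 + M < 2\<close>.\<close>
    define M where "M = max (norm x) (norm y)"
    have "0 \<le> M" "M < 1"
      using xy by (auto simp: M_def max_def)
    then have "2 / (1 + M) > 1" "2 / (1 + M) * M < 1"
      by (auto simp: field_simps)
    moreover have "2 / (1 + M) * norm x \<le> 2 / (1 + M) * M" "2 / (1 + M) * norm y \<le> 2 / (1 + M) * M"
      using \<open>0 \<le> M\<close> by (intro mult_left_mono; simp add: M_def)+
    ultimately show ?thesis
      by (intro exI[of _ "2 / (1 + M)"]) linarith
  qed
  then obtain q where q: "1 < q" "q * norm x < 1" "q * norm y < 1"
    by blast
  have "\<exists>r>0. (\<lambda>a. \<Sum>\<^sub>\<infinity>p. T p a) holomorphic_on ball z r" if "z \<in> S" for z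
  proof -
    obtain r where r: "r > 0" "cball z r \<subseteq> S"
      using \<open>open S\<close> \<open>z \<in> S\<close> open_contains_cball by blast
    let ?K = "cball z r"
    have cont: "continuous_on ?K \<alpha>" "continuous_on ?K \<beta>" "continuous_on ?K \<beta>'" "continuous_on ?K \<gamma>"
      using hol r by (auto intro: holomorphic_on_imp_continuous_on holomorphic_on_subset)
    obtain C where C: "C \<ge> 0"
      "\<And>a n. a \<in> ?K \<Longrightarrow> norm (pochhammer (\<alpha> a) n / pochhammer (\<gamma> a) n) \<le> C * q ^ n"
      using pochhammer_ratio_bound[OF compact_cball cont(1,4) _ q(1)] \<gamma> r by blast
    have "bounded (\<beta> ` ?K \<union> \<beta>' ` ?K)"
      using cont by (auto intro!: compact_imp_bounded compact_continuous_image simp del: image_Un)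
    then obtain R where R: "\<And>a. a \<in> ?K \<Longrightarrow> norm (\<beta> a) \<le> R" "\<And>a. a \<in> ?K \<Longrightarrow> norm (\<beta>' a) \<le> R"
      unfolding bounded_iff by blast
    have "z \<in> ?K"
      using r by simp
    then have "0 \<le> R"
      using R(1) norm_ge_zero order_trans by blast
    define M where "M = (\<lambda>p. C * (case p of (m, n) \<Rightarrow>
      pochhammer R m / fact m * (q * norm x) ^ m * (pochhammer R n / fact n * (q * norm y) ^ n)))"
    \<comment> \<open>The sum is unconditional, so the limit runs along the filter of finite index
      sets; the theorem on uniform limits of holomorphic functions holds for any nontrivial
      filter.\<close>
    have ulim: "uniform_limit ?K (\<lambda>X a. \<Sum>p\<in>X. T p a) (\<lambda>a. \<Sum>\<^sub>\<infinity>p. T p a) (finite_subsets_at_top UNIV)"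
    proof (rule Weierstrass_m_test_general)
      show "M summable_on UNIV"
        unfolding M_def using q \<open>0 \<le> R\<close>
        by (intro summable_on_cmult_right summable_on_double_binomial) auto
      fix p :: "nat \<times> nat" and a assume a: "a \<in> ?K"
      obtain m n where p: "p = (m, n)"
        by fastforce
      have "T p a = (pochhammer (\<alpha> a) (m + n) / pochhammer (\<gamma> a) (m + n)) *
          ((pochhammer (\<beta> a) m / fact m * x ^ m) * (pochhammer (\<beta>' a) n / fact n * y ^ n))"
        by (simp add: T_def p pochhammer_fact mult_ac)
      also have "norm \<dots> \<le> (C * q ^ (m + n)) *
          ((pochhammer R m / fact m * norm x ^ m) * (pochhammer R n / fact n * norm y ^ n))"
        using C a R q
        by (subst norm_mult, intro mult_mono norm_double_binomial_term_le) auto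
      also have "\<dots> = M p"
        by (simp add: M_def p power_add power_mult_distrib)
      finally show "norm (T p a) \<le> M p" .
    qed
    have "continuous_on ?K (T p)" "T p holomorphic_on ball z r" for p
      using holomorphic_on_subset[OF holT r(2), of p] ball_subset_cball holomorphic_on_subset
      by (blast intro: holomorphic_on_imp_continuous_on)+
    then have ev: "\<forall>\<^sub>F X in finite_subsets_at_top UNIV.
        continuous_on ?K (\<lambda>a. \<Sum>p\<in>X. T p a) \<and> (\<lambda>a. \<Sum>p\<in>X. T p a) holomorphic_on ball z r"
      by (intro always_eventually allI conjI continuous_on_sum holomorphic_on_sum)
    have "(\<lambda>a. \<Sum>\<^sub>\<infinity>p. T p a) holomorphic_on ball z r"
      by (rule holomorphic_uniform_limit[OF ev ulim finite_subsets_at_top_neq_bot])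
    then show ?thesis
      using r(1) by blast
  qed
  then have "(\<lambda>a. \<Sum>\<^sub>\<infinity>p. T p a) field_differentiable at z" if "z \<in> S" for z
    using that holomorphic_on_imp_differentiable_at open_ball centre_in_ball by blast
  then show ?thesis
    unfolding T by (auto simp: holomorphic_on_def intro: field_differentiable_at_within)
qed

section \<open>Euler's integral\<close>

text \<open>The moments of the Beta weight: with \<open>\<delta> = \<gamma> - \<alpha>\<close>,
  shifting by \<open>m + n\<close> produces exactly the quotient of the \<open>\<alpha>\<close> and
  \<open>\<gamma>\<close> symbols in Appell's series.\<close>

lemma Beta_shift_numerator:
  fixes \<alpha> \<delta> :: real
  assumes "0 < \<alpha>" "0 < \<delta>"
  shows "Beta (\<alpha> + real n) \<delta> = Beta \<alpha> \<delta> * (pochhammer \<alpha> n / pochhammer (\<alpha> + \<delta>) n)"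
proof -
  have "x \<notin> \<int>\<^sub>\<le>\<^sub>0" "Gamma x \<noteq> 0" if "0 < x" for x :: real
    using that by (auto simp: Gamma_eq_zero_iff elim!: nonpos_Ints_cases)
  then show ?thesis
    using assms pochhammer_Gamma[of \<alpha> n] pochhammer_Gamma[of "\<alpha> + \<delta>" n]
    by (simp add: Beta_def add_ac)
qed

text \<open>Expand both algebraic factors in binomial series and integrate term by term. The bounds
  on \<open>\<alpha>\<close> and \<open>\<gamma>\<close> make both exponents of the weight positive,
  so the weight is continuous and at most 1 on the closed interval and uniform convergence suffices
  for the exchange.\<close>

lemma appell_F1_Euler_integral:
  fixes \<alpha> \<beta> \<beta>' \<gamma> x y :: real
  assumes \<alpha>: "1 < \<alpha>" and \<gamma>: "\<alpha> + 1 < \<gamma>" and xy: "\<bar>x\<bar> < 1" "\<bar>y\<bar> < 1"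
    and int: "((\<lambda>t. t powr (\<alpha> - 1) * (1 - t) powr (\<gamma> - \<alpha> - 1) *
      ((1 - x * t) powr (- \<beta>) * (1 - y * t) powr (- \<beta>'))) has_integral I) {0..1}"
  shows "appell_F1 (of_real \<alpha>) (of_real \<beta>) (of_real \<beta>') (of_real \<gamma>) (of_real x) (of_real y) =
    of_real (I / Beta \<alpha> (\<gamma> - \<alpha>))"
proof -
  define w where "w = (\<lambda>t. t powr (\<alpha> - 1) * (1 - t) powr (\<gamma> - \<alpha> - 1))"
  define f where "f = (\<lambda>p t. w t * (case p of (m, n) \<Rightarrow>
    pochhammer \<beta> m / fact m * (x * t) ^ m * (pochhammer \<beta>' n / fact n * (y * t) ^ n)))"
  define g where "g = (\<lambda>t. w t * ((1 - x * t) powr (- \<beta>) * (1 - y * t) powr (- \<beta>')))"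
  define c where "c = (\<lambda>(m, n). pochhammer \<alpha> (m + n) * pochhammer \<beta> m * pochhammer \<beta>' n /
    (pochhammer \<gamma> (m + n) * pochhammer 1 m * pochhammer 1 n) * x ^ m * y ^ n)"
  let ?B = "Beta \<alpha> (\<gamma> - \<alpha>)"
  have small: "\<bar>x * t\<bar> \<le> \<bar>x\<bar>" "\<bar>y * t\<bar> \<le> \<bar>y\<bar>" if "t \<in> {0..1}" for t
    using that by (auto simp: abs_mult mult_left_le)
  have w: "0 \<le> w t" "w t \<le> 1" if "t \<in> {0..1}" for t
    using that \<alpha> \<gamma> by (auto simp: w_def intro!: mult_le_one powr_le1)
  have cont_w: "continuous_on {0..1} w"
    unfolding w_def using \<alpha> \<gamma>
    by (intro continuous_on_mult continuous_on_powr' continuous_intros) auto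
  have fint: "(f p has_integral ?B * c p) {0..1}" for p
  proof -
    obtain m n where p: "p = (m, n)"
      by fastforce
    let ?k = "pochhammer \<beta> m / fact m * x ^ m * (pochhammer \<beta>' n / fact n * y ^ n)"
    have int: "((\<lambda>t. ?k * (t powr (\<alpha> + real (m + n) - 1) * (1 - t) powr (\<gamma> - \<alpha> - 1))) has_integral
        ?k * Beta (\<alpha> + real (m + n)) (\<gamma> - \<alpha>)) {0..1}"
      using \<alpha> \<gamma> by (intro has_integral_mult_right has_integral_Beta_real) auto
    have eq: "?k * Beta (\<alpha> + real (m + n)) (\<gamma> - \<alpha>) = ?B * c p"
      using \<alpha> \<gamma> by (subst Beta_shift_numerator) (auto simp: c_def p pochhammer_fact mult_ac)
    have "?k * (t powr (\<alpha> + real (m + n) - 1) * (1 - t) powr (\<gamma> - \<alpha> - 1)) = f p t"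
      if "t \<in> {0..1}" for t
    proof -
      \<comment> \<open>At \<open>t = 0\<close> both sides are 0, even for \<open>m + n = 0\<close>,
        because \<open>0 powr e = 0\<close>.\<close>
      have "t powr (\<alpha> + real (m + n) - 1) = t powr (\<alpha> - 1) * t ^ (m + n)"
        using that by (cases "t = 0") (auto simp: powr_add powr_diff powr_realpow power_add)
      then show ?thesis
        by (simp add: f_def w_def p power_add power_mult_distrib)
    qed
    from has_integral_eq[OF this int] show ?thesis
      unfolding eq .
  qed
  \<comment> \<open>On the unit interval \<open>x * t\<close> and \<open>y * t\<close> are no larger
    in absolute value than \<open>x\<close> and \<open>y\<close>, so one majorant serves all
    \<open>t\<close>.\<close>
  have ulim: "uniform_limit {0..1} (\<lambda>X t. \<Sum>p\<in>X. f p t) g (finite_subsets_at_top UNIV)"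
  proof (rule Weierstrass_m_test_general')
    show "(\<lambda>(m, n). pochhammer \<bar>\<beta>\<bar> m / fact m * \<bar>x\<bar> ^ m * (pochhammer \<bar>\<beta>'\<bar> n / fact n * \<bar>y\<bar> ^ n))
        summable_on UNIV"
      using xy by (intro summable_on_double_binomial) auto
    show "((\<lambda>p. f p t) has_sum g t) UNIV" if "t \<in> {0..1}" for t
      unfolding f_def g_def
      using small[OF that] xy by (intro has_sum_cmult_right double_binomial_has_sum) auto
    show "norm (f p t) \<le> (\<lambda>(m, n). pochhammer \<bar>\<beta>\<bar> m / fact m * \<bar>x\<bar> ^ m *
        (pochhammer \<bar>\<beta>'\<bar> n / fact n * \<bar>y\<bar> ^ n)) p" if "t \<in> {0..1}" for p t
    proof -
      obtain m n where p: "p = (m, n)"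
        by fastforce
      have "norm (f p t) \<le> 1 * (pochhammer \<bar>\<beta>\<bar> m / fact m * \<bar>x\<bar> ^ m *
          (pochhammer \<bar>\<beta>'\<bar> n / fact n * \<bar>y\<bar> ^ n))"
        unfolding f_def p prod.case using small[OF that] w[OF that]
        by (subst norm_mult, intro mult_mono norm_double_binomial_term_le) auto
      then show ?thesis
        by (simp add: p)
    qed
  qed
  have "continuous_on {0..1} (\<lambda>t. \<Sum>p\<in>X. f p t)" for X
    unfolding f_def case_prod_beta by (intro continuous_intros cont_w)
  then obtain J K where J: "\<And>X. ((\<lambda>t. \<Sum>p\<in>X. f p t) has_integral J X) {0..1}"
    and K: "(g has_integral K) {0..1}" "(J \<longlongrightarrow> K) (finite_subsets_at_top UNIV)"
    using uniform_limit_integral[OF ulim] finite_subsets_at_top_neq_bot by blast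
  have "K = I"
    using K(1) int by (simp add: g_def w_def has_integral_unique)
  \<comment> \<open>\<open>J X\<close> is the finite sum of the termwise integrals, so convergence
    of \<open>J\<close> to \<open>I\<close> is by definition a \<open>has_sum\<close>
    statement.\<close>
  have "\<forall>\<^sub>F X in finite_subsets_at_top UNIV. J X = (\<Sum>p\<in>X. ?B * c p)"
    by (intro eventually_finite_subsets_at_top_weakI) (meson J fint has_integral_sum has_integral_unique)
  with K(2) \<open>K = I\<close> have "((\<lambda>p. ?B * c p) has_sum I) UNIV"
    unfolding has_sum_def by (simp add: tendsto_cong)
  then have "((\<lambda>p. 1 / ?B * (?B * c p)) has_sum 1 / ?B * I) UNIV"
    by (rule has_sum_cmult_right)
  moreover have "?B \<noteq> 0"
    using \<alpha> \<gamma> by (simp add: Beta_def Gamma_eq_zero_iff) (auto elim!: nonpos_Ints_cases)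
  ultimately have "(c has_sum I / ?B) UNIV"
    by simp
  then have "((\<lambda>p. complex_of_real (c p)) has_sum of_real (I / ?B)) UNIV"
    by (rule has_sum_of_real)
  also have "(\<lambda>p. complex_of_real (c p)) = (\<lambda>(m, n). (pochhammer (of_real \<alpha>) (m + n) *
      pochhammer (of_real \<beta>) m * pochhammer (of_real \<beta>') n) / (pochhammer (of_real \<gamma>) (m + n) *
      pochhammer 1 m * pochhammer 1 n) * of_real x ^ m * of_real y ^ n)"
    by (auto simp: c_def fun_eq_iff pochhammer_prod)
  finally show ?thesis
    unfolding appell_F1_def by (rule infsumI)
qed

section \<open>The special integral\<close>

text \<open>To be read with \<open>r = 1 - t\<close>, \<open>m = 1 - 125 t / 128\<close>,
  \<open>n = 1 - 5 t / 8\<close>: the left side is the Beta integrand pulled back along the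
  substitution, the right side a constant times Euler's integrand. In logarithms the claim is
  linear; for instance \<open>- (a - 1) - 3 / 2 = - (a + 1 / 2)\<close> and
  \<open>- 5 * (a - 1) - 7 / 2 = - (5 * a - 3 / 2)\<close>.\<close>

lemma pullback_Beta_integrand:
  fixes a k m n r t :: real
  assumes "0 < t" "0 < r" "0 < m" "0 < n" "0 < k"
  shows "(t ^ 2 * r ^ 3 / (k * m * n ^ 5)) powr (a - 1) *
      (2 / k * t * r ^ 2 * m powr (- 3 / 2) * n powr (- 7 / 2)) =
    2 * k powr (- a) * (t powr (2 * a - 1) * r powr (3 * a - 1) *
      (m powr (- (a + 1 / 2)) * n powr (- (5 * a - 3 / 2))))"
proof -
  obtain T R M N K where e: "t = exp T" "r = exp R" "m = exp M" "n = exp N" "k = exp K"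
    using assms by (metis exp_ln)
  have "exp T ^ 2 = exp (2 * T)" "exp R ^ 2 = exp (2 * R)" "exp R ^ 3 = exp (3 * R)"
    "exp N ^ 5 = exp (5 * N)"
    using exp_of_nat_mult[of 2 T] exp_of_nat_mult[of 2 R] exp_of_nat_mult[of 3 R]
      exp_of_nat_mult[of 5 N] by (simp_all only: of_nat_numeral)
  then have base: "t ^ 2 * r ^ 3 / (k * m * n ^ 5) = exp (2 * T + 3 * R - (K + M + 5 * N))"
    and r: "r ^ 2 = exp (2 * R)"
    by (simp_all only: e exp_add exp_diff)
  have powr_exp: "exp x powr y = exp (y * x)" for x y :: real
    by (simp add: powr_def)
  have "2 / k = 2 * exp (- K)"
    by (simp add: e exp_minus divide_inverse)
  then have "(t ^ 2 * r ^ 3 / (k * m * n ^ 5)) powr (a - 1) *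
      (2 / k * t * r ^ 2 * m powr (- 3 / 2) * n powr (- 7 / 2)) =
    exp ((a - 1) * (2 * T + 3 * R - (K + M + 5 * N))) *
      (2 * exp (- K) * exp T * exp (2 * R) * exp (- 3 / 2 * M) * exp (- 7 / 2 * N))"
    unfolding base r by (simp only: e powr_exp)
  also have "\<dots> = 2 * exp ((a - 1) * (2 * T + 3 * R - (K + M + 5 * N)) + - K + T + 2 * R +
      - 3 / 2 * M + - 7 / 2 * N)"
    by (simp only: exp_add mult_ac)
  also have "(a - 1) * (2 * T + 3 * R - (K + M + 5 * N)) + - K + T + 2 * R + - 3 / 2 * M + - 7 / 2 * N =
      - a * K + ((2 * a - 1) * T + (3 * a - 1) * R + (- (a + 1 / 2) * M + - (5 * a - 3 / 2) * N))"
    by (simp add: algebra_simps)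
  also have "2 * exp \<dots> = 2 * k powr (- a) * (t powr (2 * a - 1) * r powr (3 * a - 1) *
      (m powr (- (a + 1 / 2)) * n powr (- (5 * a - 3 / 2))))"
    unfolding e powr_exp exp_add mult.assoc ..
  finally show ?thesis .
qed

text \<open>With \<open>u = 1 - 125 t / 128\<close>, \<open>v = 1 - 5 t / 8\<close> and \<open>c\<close> the cubic below,
  \<open>u v\<^sup>5 - c\<^sup>2\<close> is a constant multiple of \<open>t\<^sup>2 (1 - t)\<^sup>3\<close>.  So \<open>s = (1 - c / \<surd>(u v\<^sup>5)) / 2\<close>
  has \<open>s (1 - s)\<close> proportional to \<open>t\<^sup>2 (1 - t)\<^sup>3 / (u v\<^sup>5)\<close>; it maps 0 to 0 and 1 to 1
  (\<open>c\<close> changes sign in between), so it turns \<open>\<integral> (s (1 - s))\<^sup>a\<^sup>-\<^sup>1 ds\<close> into Euler's integral.\<close>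

lemma special_Euler_integral:
  fixes a :: real
  assumes "1 < a"
  shows "((\<lambda>t. t powr (2 * a - 1) * (1 - t) powr (3 * a - 1) *
      ((1 - 125 / 128 * t) powr (- (a + 1 / 2)) * (1 - 5 / 8 * t) powr (- (5 * a - 3 / 2))))
    has_integral (262144 / 84375) powr a / 2 * Beta a a) {0..1}"
proof -
  \<comment> \<open>\<open>K = 2 ^ 18 / (3 ^ 3 * 5 ^ 5)\<close> normalises the Belyi map:
    \<open>u v^5 - c^2 = (4 / K) t^2 (1 - t)^3\<close>. Its power \<open>K powr a\<close> becomes
    the elementary factor of the final formula.\<close>
  define K :: real where "K = 262144 / 84375"
  define u v c :: "real \<Rightarrow> real" where "u = (\<lambda>t. 1 - 125 / 128 * t)" and "v = (\<lambda>t. 1 - 5 / 8 * t)"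
    and "c = (\<lambda>t. 1 - 525 / 256 * t + 375 / 512 * t ^ 2 + 625 / 2048 * t ^ 3)"
  define s where "s = (\<lambda>t. (1 - c t * (u t powr (- 1 / 2) * v t powr (- 5 / 2))) / 2)"
  define s' where "s' = (\<lambda>t. 2 / K * t * (1 - t) ^ 2 * u t powr (- 3 / 2) * v t powr (- 7 / 2))"
  define F :: "real \<Rightarrow> real" where "F = (\<lambda>z. (z * (1 - z)) powr (a - 1))"
  define E where "E = (\<lambda>t. t powr (2 * a - 1) * (1 - t) powr (3 * a - 1) *
      (u t powr (- (a + 1 / 2)) * v t powr (- (5 * a - 3 / 2))))"
  have uv: "0 < u t" "0 < v t" if "t \<in> {0..1}" for t
    using that by (auto simp: u_def v_def)
  have s_prod: "s t * (1 - s t) = t ^ 2 * (1 - t) ^ 3 / (K * u t * v t ^ 5)" if "t \<in> {0..1}" for t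
  proof -
    have "(u t powr (- 1 / 2)) ^ 2 = u t powr - 1" "(v t powr (- 5 / 2)) ^ 2 = v t powr - 5"
      by (simp_all add: power2_eq_square flip: powr_add)
    then have "(u t powr (- 1 / 2)) ^ 2 = 1 / u t" "(v t powr (- 5 / 2)) ^ 2 = 1 / v t ^ 5"
      using uv[OF that] by (simp_all add: powr_minus_divide)
    moreover have "s t * (1 - s t) =
        (1 - c t ^ 2 * ((u t powr (- 1 / 2)) ^ 2 * (v t powr (- 5 / 2)) ^ 2)) / 4"
      by (simp add: s_def power2_eq_square field_simps)
    ultimately have "s t * (1 - s t) = (1 - c t ^ 2 * (1 / u t * (1 / v t ^ 5))) / 4"
      by simp
    also have "\<dots> = (u t * v t ^ 5 - c t ^ 2) / (4 * (u t * v t ^ 5))"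
      using uv[OF that] by (simp add: field_simps)
    also have "u t * v t ^ 5 - c t ^ 2 = 4 / K * (t ^ 2 * (1 - t) ^ 3)"
      by (simp add: u_def v_def c_def K_def) algebra
    finally show ?thesis
      by (simp add: mult_ac)
  qed
  \<comment> \<open>A real \<open>z\<close> with \<open>z * (1 - z) \<ge> 0\<close> lies in the unit
    interval, so no monotonicity of \<open>s\<close> has to be shown.\<close>
  have s_range: "s t \<in> {0..1}" if "t \<in> {0..1}" for t
  proof -
    have "0 \<le> s t * (1 - s t)"
      using that uv[OF that] by (simp add: s_prod K_def)
    then show ?thesis
      by (auto simp: zero_le_mult_iff)
  qed
  have s_deriv: "(s has_real_derivative s' t) (at t within {0..1})" if "t \<in> {0..1}" for t
  proof -
    have du: "(u has_real_derivative - (125 / 128)) (at t within {0..1})"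
      and dv: "(v has_real_derivative - (5 / 8)) (at t within {0..1})"
      and dc: "(c has_real_derivative - 525 / 256 + 375 / 256 * t + 1875 / 2048 * t ^ 2) (at t within {0..1})"
      unfolding u_def v_def c_def by (auto intro!: derivative_eq_intros)
    have dpowr: "((\<lambda>t. w t powr e) has_real_derivative e * w t powr (e - 1) * w') (at t within {0..1})"
      if "(w has_real_derivative w') (at t within {0..1})" "0 < w t" for w w' e
      using DERIV_chain2[OF has_real_derivative_powr[OF that(2)] that(1)] .
    \<comment> \<open>Lowering the exponents by one gives all terms of the derivative the common
      factor \<open>u^(-3/2) v^(-7/2)\<close>, leaving a polynomial identity.\<close>
    have shift: "u t powr (- 1 / 2) = u t * u t powr (- 3 / 2)"
      "v t powr (- 5 / 2) = v t * v t powr (- 7 / 2)"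
      using uv[OF that] powr_mult_base[of "u t" "- 3 / 2"] powr_mult_base[of "v t" "- 7 / 2"] by auto
    have "(s has_real_derivative
        (0 - ((- 525 / 256 + 375 / 256 * t + 1875 / 2048 * t ^ 2) * (u t powr (- 1 / 2) * v t powr (- 5 / 2)) +
          ((- 1 / 2 * u t powr (- 1 / 2 - 1) * - (125 / 128)) * v t powr (- 5 / 2) +
           (- 5 / 2 * v t powr (- 5 / 2 - 1) * - (5 / 8)) * u t powr (- 1 / 2)) * c t)) / 2)
        (at t within {0..1})" (is "(_ has_real_derivative ?d) _")
      unfolding s_def
      by (rule DERIV_cdivide[OF DERIV_diff[OF DERIV_const DERIV_mult[OF dc DERIV_mult[OF
        dpowr[OF du uv(1)[OF that]] dpowr[OF dv uv(2)[OF that]]]]]])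
    also have "?d = u t powr (- 3 / 2) * v t powr (- 7 / 2) *
        (- ((- 525 / 256 + 375 / 256 * t + 1875 / 2048 * t ^ 2) * (u t * v t) +
          (125 / 256 * v t + 25 / 16 * u t) * c t) / 2)"
      unfolding shift by (simp add: algebra_simps)
    \<comment> \<open>The double zero of \<open>s (1 - s)\<close> at 0 leaves a factor
      \<open>t\<close>, the triple zero at 1 a factor \<open>(1 - t)^2\<close>. The polynomial has
      no other zeros, so the pullback is a single Euler integrand.\<close>
    also have "- ((- 525 / 256 + 375 / 256 * t + 1875 / 2048 * t ^ 2) * (u t * v t) +
        (125 / 256 * v t + 25 / 16 * u t) * c t) / 2 = 2 / K * t * (1 - t) ^ 2"
      by (simp add: u_def v_def c_def K_def) algebra
    finally show ?thesis
      by (simp add: s'_def mult_ac)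
  qed
  have s_0: "s 0 = 0"
    by (simp add: s_def u_def v_def c_def)
  have s_1: "s 1 = 1"
  proof -
    \<comment> \<open>\<open>s 1\<close> is a root of \<open>z (1 - z)\<close>; the negative value
      \<open>c 1 = -27 / 2048\<close> gives \<open>s 1 > 1 / 2\<close> and so selects the root
      1.\<close>
    have "u 1 powr (- 1 / 2) * v 1 powr (- 5 / 2) > 0"
      using uv[of 1] by simp
    then have "s 1 > 1 / 2"
      by (simp add: s_def c_def)
    moreover have "s 1 * (1 - s 1) = 0"
      by (subst s_prod) auto
    ultimately show ?thesis
      by auto
  qed
  have "continuous_on {0..1} F"
    unfolding F_def using assms by (intro continuous_on_powr' continuous_intros) auto
  then have subst: "((\<lambda>t. s' t *\<^sub>R F (s t)) has_integral integral {s 0..s 1} F) {0..1}"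
    using s_range s_deriv
    by (intro has_integral_substitution[where c = 0 and d = 1]) (auto simp: s_0 s_1)
  have F_eq: "z powr (a - 1) * (1 - z) powr (a - 1) = F z" if "z \<in> {0..1}" for z
    using that by (simp add: F_def powr_mult)
  have "(F has_integral Beta a a) {0..1}"
    by (rule has_integral_eq[OF F_eq has_integral_Beta_real]) (use assms in auto)
  then have int_F: "integral {s 0..s 1} F = Beta a a"
    unfolding s_0 s_1 by (rule integral_unique)
  have "s' t *\<^sub>R F (s t) = 2 * K powr (- a) * E t" if "t \<in> {0..1}" for t
  \<comment> \<open>The pullback identity needs \<open>t\<close> and \<open>1 - t\<close> positive.
    At the endpoints both sides vanish: \<open>s'\<close> has the factors \<open>t\<close> and
    \<open>(1 - t) ^ 2\<close>, and \<open>E\<close> contains a power of 0.\<close>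
  proof (cases "t = 0 \<or> t = 1")
    case True
    then show ?thesis
      by (auto simp: s'_def E_def)
  next
    case False
    then show ?thesis
      using pullback_Beta_integrand[of t "1 - t" "u t" "v t" K a] uv[OF that] that
      by (simp add: F_def s_prod E_def s'_def K_def mult_ac)
  qed
  from has_integral_eq[OF this subst]
  have "((\<lambda>t. 2 * K powr (- a) * E t) has_integral Beta a a) {0..1}"
    unfolding int_F .
  then have "((\<lambda>t. K powr a / 2 * (2 * K powr (- a) * E t)) has_integral K powr a / 2 * Beta a a) {0..1}"
    by (rule has_integral_mult_right)
  moreover have "K powr a / 2 * (2 * K powr (- a) * E t) = E t" for t
    by (simp add: K_def flip: powr_add mult.assoc)
  ultimately show ?thesis
    unfolding E_def u_def v_def K_def by (simp only:)
qed

text \<open>Dividing the special integral by \<open>Beta (2 * a) (3 * a)\<close> leaves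
  \<open>Beta a a / Beta (2 * a) (3 * a)\<close>, which is the Gamma quotient; each Beta value
  contributes one factor \<open>1 / Gamma (2 * a)\<close>.\<close>

lemma special_value_real:
  fixes a :: real
  assumes "1 < a"
  shows "appell_F1 (2 * of_real a) (of_real a + 1 / 2) (5 * of_real a - 3 / 2) (5 * of_real a) (125 / 128) (5 / 8) =
    2 powr (18 * of_real a - 1) / (3 powr (3 * of_real a) * 5 powr (5 * of_real a)) *
    (Gamma (of_real a) ^ 2 * Gamma (5 * of_real a) * rGamma (2 * of_real a) ^ 2 * rGamma (3 * of_real a))"
proof -
  have "appell_F1 (of_real (2 * a)) (of_real (a + 1 / 2)) (of_real (5 * a - 3 / 2)) (of_real (5 * a))
      (of_real (125 / 128)) (of_real (5 / 8)) =
    of_real ((262144 / 84375) powr a / 2 * Beta a a / Beta (2 * a) (5 * a - 2 * a))"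
    using assms special_Euler_integral[OF assms] by (intro appell_F1_Euler_integral) auto
  also have "(262144 / 84375) powr a / 2 * Beta a a / Beta (2 * a) (5 * a - 2 * a) =
    2 powr (18 * a - 1) / (3 powr (3 * a) * 5 powr (5 * a)) *
    (Gamma a ^ 2 * Gamma (5 * a) * rGamma (2 * a) ^ 2 * rGamma (3 * a))"
  proof -
    have "(262144 / 84375 :: real) = 2 powr 18 / (3 powr 3 * 5 powr 5)"
      by simp
    then have "(262144 / 84375) powr a = 2 powr (18 * a) / (3 powr (3 * a) * 5 powr (5 * a))"
      by (simp only: powr_divide powr_mult powr_powr)
    then show ?thesis
      by (simp add: Beta_def rGamma_inverse_Gamma powr_diff power2_eq_square divide_simps)
  qed
  finally show ?thesis
    by (simp flip: powr_of_real Gamma_complex_of_real rGamma_complex_of_real)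
qed

section \<open>Analytic continuation in the parameter\<close>

theorem mainTheorem11:
  fixes a :: complex
  assumes "5 * a \<notin> \<int>\<^sub>\<le>\<^sub>0"
  shows "appell_F1 (2 * a) (a + 1 / 2) (5 * a - 3 / 2) (5 * a) (125 / 128) (5 / 8) =
    2 powr (18 * a - 1) / (3 powr (3 * a) * 5 powr (5 * a)) *
    (Gamma a ^ 2 * Gamma (5 * a) * rGamma (2 * a) ^ 2 * rGamma (3 * a))"
proof -
  define S :: "complex set" where "S = {a. 5 * a \<notin> \<int>\<^sub>\<le>\<^sub>0}"
  define f where "f = (\<lambda>a :: complex. appell_F1 (2 * a) (a + 1 / 2) (5 * a - 3 / 2) (5 * a) (125 / 128) (5 / 8) -
    2 powr (18 * a - 1) / (3 powr (3 * a) * 5 powr (5 * a)) *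
    (Gamma a ^ 2 * Gamma (5 * a) * rGamma (2 * a) ^ 2 * rGamma (3 * a)))"
  have "S = (\<lambda>a. 5 * a) -` (- \<int>\<^sub>\<le>\<^sub>0)"
    by (auto simp: S_def)
  moreover have "open ((\<lambda>a :: complex. 5 * a) -` (- \<int>\<^sub>\<le>\<^sub>0))"
    by (intro open_vimage open_Compl closed_nonpos_Ints continuous_intros)
  ultimately have "open S"
    by simp
  \<comment> \<open>Removing a countable set from the plane leaves it connected, as the identity
    theorem requires.\<close>
  have "S = UNIV - range (\<lambda>n. - of_nat n / 5)"
  proof (intro equalityI subsetI)
    fix a assume "a \<in> S"
    then show "a \<in> UNIV - range (\<lambda>n. - of_nat n / 5)"
      by (auto simp: S_def)
  next
    fix a :: complex assume a: "a \<in> UNIV - range (\<lambda>n. - of_nat n / 5)"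
    have "5 * a \<noteq> - of_nat n" for n
    proof
      assume "5 * a = - of_nat n"
      then have "a = - of_nat n / 5"
        by (simp add: field_simps)
      then show False
        using a by blast
    qed
    then show "a \<in> S"
      by (auto simp: S_def elim: nonpos_Ints_cases')
  qed
  then have "connected S"
    using connected_open_diff_countable[of "UNIV :: complex set" "range (\<lambda>n. - of_nat n / 5)"]
    by (simp add: connected_UNIV)
  have a: "a \<notin> \<int>\<^sub>\<le>\<^sub>0" if "a \<in> S" for a
  proof
    assume "a \<in> \<int>\<^sub>\<le>\<^sub>0"
    then obtain n where "a = - of_nat n"
      by (auto elim: nonpos_Ints_cases')
    then have "5 * a = - of_nat (5 * n)"
      by simp
    also have "\<dots> \<in> \<int>\<^sub>\<le>\<^sub>0"
      by blast
    finally show False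
      using that by (simp add: S_def)
  qed
  have hol_F1: "(\<lambda>a. appell_F1 (2 * a) (a + 1 / 2) (5 * a - 3 / 2) (5 * a) (125 / 128) (5 / 8)) holomorphic_on S"
    by (rule appell_F1_holomorphic[OF \<open>open S\<close>])
      (auto simp: S_def intro!: holomorphic_intros)
  \<comment> \<open>On \<open>S\<close> neither \<open>a\<close> nor \<open>5 * a\<close> is a pole
    of \<open>Gamma\<close>. But \<open>2 * a\<close> or \<open>3 * a\<close> can be one, as at
    \<open>a = - 1 / 2\<close> or \<open>a = - 1 / 3\<close>; there the entire function
    \<open>rGamma\<close> is zero.\<close>
  have hol_Gamma: "(\<lambda>a. Gamma a ^ 2 * Gamma (5 * a) * rGamma (2 * a) ^ 2 * rGamma (3 * a)) holomorphic_on S"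
    using a
    by (intro holomorphic_on_mult holomorphic_on_power holomorphic_Gamma' holomorphic_rGamma'
        holomorphic_on_ident holomorphic_on_const) (auto simp: S_def)
  have hol_powr: "(\<lambda>a. 2 powr (18 * a - 1) / (3 powr (3 * a) * 5 powr (5 * a)) :: complex) holomorphic_on S"
    by (intro holomorphic_on_divide holomorphic_on_mult holomorphic_on_powr_right holomorphic_on_diff
        holomorphic_on_ident holomorphic_on_const) auto
  have "f holomorphic_on S"
    unfolding f_def by (rule holomorphic_on_diff[OF hol_F1 holomorphic_on_mult[OF hol_powr hol_Gamma]])
  moreover have "f z = 0" if "z \<in> of_real ` {1<..}" for z
    using that special_value_real by (auto simp: f_def)
  moreover have "of_real ` {1<..} \<subseteq> S"
    by (auto simp: S_def elim!: nonpos_Ints_cases' simp: complex_eq_iff)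
  \<comment> \<open>Any point of the ray would do as an accumulation point of the zeros of
    \<open>f\<close>; 2 is an interior one.\<close>
  moreover have "(2 :: complex) islimpt of_real ` {1<..}"
    unfolding islimpt_approachable
  proof (intro allI impI)
    fix e :: real assume "0 < e"
    then have "complex_of_real (2 + e / 2) \<in> of_real ` {1<..}"
      by (intro imageI) simp
    moreover have "complex_of_real (2 + e / 2) \<noteq> 2" "dist (complex_of_real (2 + e / 2)) 2 < e"
      using \<open>0 < e\<close> by (simp_all add: dist_norm norm_divide)
    ultimately show "\<exists>x\<in>complex_of_real ` {1<..}. x \<noteq> 2 \<and> dist x 2 < e"
      by blast
  qed
  moreover have "2 \<in> S"
    by (auto simp: S_def elim!: nonpos_Ints_cases' simp: complex_eq_iff)
  ultimately have "f a = 0"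
    using analytic_continuation[of f S "of_real ` {1<..}" 2 a] \<open>open S\<close> \<open>connected S\<close> assms
    by (simp add: S_def)
  then show ?thesis
    by (simp add: f_def)
qed

end
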